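(* Let the wave speed, the emitter trajectory $\boldsymbol{z}$ and the four receiver trajectories $\boldsymbol{x}_1,\dots,\boldsymbol{x}_4$ be given. There exist mappings $\mathcal{G}$ and $\mathcal{F}$, determined by these given data and not depending on the scatterer trajectory, such that for every admissible scatterer trajectory $\boldsymbol{y}$, with associated distance functions $d_{\boldsymbol{x}_1},\dots,d_{\boldsymbol{x}_4}$ and $d_{\boldsymbol{z}}$ and associated time $T_0$, $$\boldsymbol{y}(t)=\mathcal{G}[d_{\boldsymbol{x}_1},d_{\boldsymbol{x}_2},d_{\boldsymbol{x}_3},d_{\boldsymbol{x}_4}](t)\quad\text{for all }t\ge0,$$ and $$d_{\boldsymbol{z}}(t)=\mathcal{F}[d_{\boldsymbol{x}_1},d_{\boldsymbol{x}_2},d_{\boldsymbol{x}_3},d_{\boldsymbol{x}_4}](t)\quad\text{for all }t\ge T_0.$$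
   Context: $c>0$ is the wave speed. The emitter trajectory $\boldsymbol{z}$, the scatterer trajectory $\boldsymbol{y}$ and the four receiver trajectories $\boldsymbol{x}_1,\dots,\boldsymbol{x}_4$ are $C^1$ maps $[0,\infty)\to\mathbb{R}^3$ satisfying (these are the conditions making $\boldsymbol{y}$ admissible): (i) there is $c_0\in(0,c)$ such that all their speeds are $<c_0$ for all $t>0$; (ii) there are smooth bounded domains $\Omega_1\subset\Omega_2$ with $\boldsymbol{y}(t)\in\Omega_1$ and $\boldsymbol{z}(t),\boldsymbol{x}_i(t)\in\mathbb{R}^3\setminus\overline{\Omega_2}$ for all $t\ge0$, and the emitter and receiver trajectories do not intersect each other over $(0,T)$ for some sufficiently large $T>0$; (iii) for any positive times $t_1,t_2,t_3,t_4>0$ the points $\boldsymbol{x}_1(t_1),\boldsymbol{x}_2(t_2),\boldsymbol{x}_3(t_3),\boldsymbol{x}_4(t_4)$ are not coplanar. Let $g_{\boldsymbol{z}}(t,s)=t-s-|\boldsymbol{y}(t)-\boldsymbol{z}(s)|/c$ and $g_{\boldsymbol{x}_i}(t,s)=t-s-|\boldsymbol{x}_i(t)-\boldsymbol{y}(s)|/c$ on $[0,\infty)\times[0,\infty)$. $T_0>0$ is the time with $g_{\boldsymbol{z}}(T_0,0)=0$. $h_{\boldsymbol{z}}$ and $h_{\boldsymbol{x}_i}$ are the unique strictly increasing $C^1$ functions on $[0,\infty)$ with $g_{\boldsymbol{z}}(h_{\boldsymbol{z}}(s),s)=0$ and $g_{\boldsymbol{x}_i}(h_{\boldsymbol{x}_i}(s),s)=0$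 for all $s\ge0$; $h_{\boldsymbol{z}}^{-1}:[T_0,\infty)\to[0,\infty)$ is the inverse of $h_{\boldsymbol{z}}$. The distance functions are $$d_{\boldsymbol{x}_i}(t)=|\boldsymbol{x}_i(h_{\boldsymbol{x}_i}(t))-\boldsymbol{y}(t)|\ (t\ge0),\qquad d_{\boldsymbol{z}}(t)=|\boldsymbol{y}(t)-\boldsymbol{z}(h_{\boldsymbol{z}}^{-1}(t))|\ (t\ge T_0).$$ *)

theory Defs
  imports "HOL-Analysis.Analysis"
begin

text \<open>Differentiability on \<open>[0,\<infinity>)\<close> is one-sided at \<open>0\<close>, so that the values of the total function
  at negative arguments are irrelevant.\<close>

definition C1_halfline :: "(real \<Rightarrow> 'a::real_normed_vector) \<Rightarrow> bool" where
  "C1_halfline f \<longleftrightarrow>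
     (\<exists>f'. (\<forall>t\<ge>0. (f has_vector_derivative f' t) (at t within {0..})) \<and> continuous_on {0..} f')"

definition speed :: "(real \<Rightarrow> 'a::real_normed_vector) \<Rightarrow> real \<Rightarrow> real" where
  "speed f t = norm (vector_derivative f (at t))"

text \<open>\<open>k\<close> times continuously differentiable on an open set, by recursion on all directional
  derivatives.\<close>

fun Ck_on :: "nat \<Rightarrow> ('a::euclidean_space \<Rightarrow> real) \<Rightarrow> 'a set \<Rightarrow> bool" where
  "Ck_on 0 f U \<longleftrightarrow> continuous_on U f"
| "Ck_on (Suc k) f U \<longleftrightarrow>
     (\<forall>p\<in>U. f differentiable (at p)) \<and>
     (\<forall>v. Ck_on k (\<lambda>p. frechet_derivative f (at p) v) U)"

text \<open>A smooth bounded domain is a nonempty bounded connected open set which, near each of its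
  boundary points, is the sublevel set of a \<open>C\<^sup>\<infinity>\<close> function without critical points.\<close>

definition smooth_bounded_domain :: "'a::euclidean_space set \<Rightarrow> bool" where
  "smooth_bounded_domain \<Omega> \<longleftrightarrow>
     \<Omega> \<noteq> {} \<and> open \<Omega> \<and> connected \<Omega> \<and> bounded \<Omega> \<and>
     (\<forall>p\<in>frontier \<Omega>. \<exists>U \<rho>. open U \<and> p \<in> U \<and> (\<forall>k. Ck_on k \<rho> U) \<and>
        (\<forall>q\<in>U. frechet_derivative \<rho> (at q) \<noteq> (\<lambda>_. 0)) \<and>
        \<Omega> \<inter> U = {q\<in>U. \<rho> q < 0})"

text \<open>Wave speed \<open>c\<close>, emitter \<open>z\<close>, receivers \<open>x i\<close>, scatterer \<open>y\<close>; trajectories only matter on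
  \<open>[0,\<infinity>)\<close>.\<close>

definition admissible ::
  "real \<Rightarrow> (real \<Rightarrow> real^3) \<Rightarrow> (4 \<Rightarrow> real \<Rightarrow> real^3) \<Rightarrow> (real \<Rightarrow> real^3) \<Rightarrow> bool" where
  "admissible c z x y \<longleftrightarrow>
     C1_halfline z \<and> C1_halfline y \<and> (\<forall>i. C1_halfline (x i)) \<and>
     (\<exists>c\<^sub>0. 0 < c\<^sub>0 \<and> c\<^sub>0 < c \<and>
        (\<forall>t>0. speed z t < c\<^sub>0 \<and> speed y t < c\<^sub>0 \<and> (\<forall>i. speed (x i) t < c\<^sub>0))) \<and>
     (\<exists>\<Omega>\<^sub>1 \<Omega>\<^sub>2. smooth_bounded_domain \<Omega>\<^sub>1 \<and> smooth_bounded_domain \<Omega>\<^sub>2 \<and> \<Omega>\<^sub>1 \<subseteq> \<Omega>\<^sub>2 \<and>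
        (\<forall>t\<ge>0. y t \<in> \<Omega>\<^sub>1 \<and> z t \<notin> closure \<Omega>\<^sub>2 \<and> (\<forall>i. x i t \<notin> closure \<Omega>\<^sub>2))) \<and>
     (\<exists>T>0. \<forall>t. 0 < t \<and> t < T \<longrightarrow>
        (\<forall>i. z t \<noteq> x i t) \<and> (\<forall>i j. i \<noteq> j \<longrightarrow> x i t \<noteq> x j t)) \<and>
     (\<forall>t. (\<forall>i. t i > 0) \<longrightarrow> \<not> coplanar (range (\<lambda>i. x i (t i))))"

text \<open>For a signal that leaves the source \<open>b\<close> at time \<open>s\<close> and is received by \<open>a\<close> at time \<open>t\<close>:
  \<open>g\<^sub>z = g_fun c y z\<close> and \<open>g\<^sub>x\<^sub>i = g_fun c (x i) y\<close>; likewise for \<open>h_fun\<close>.\<close>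

definition g_fun ::
  "real \<Rightarrow> (real \<Rightarrow> real^3) \<Rightarrow> (real \<Rightarrow> real^3) \<Rightarrow> real \<Rightarrow> real \<Rightarrow> real" where
  "g_fun c a b t s = t - s - norm (a t - b s) / c"

definition h_fun ::
  "real \<Rightarrow> (real \<Rightarrow> real^3) \<Rightarrow> (real \<Rightarrow> real^3) \<Rightarrow> real \<Rightarrow> real" where
  "h_fun c a b =
     (THE h. h \<in> {0..} \<rightarrow>\<^sub>E {0..} \<and> C1_halfline h \<and> strict_mono_on {0..} h \<and>
             (\<forall>s\<ge>0. g_fun c a b (h s) s = 0))"

definition T0 :: "real \<Rightarrow> (real \<Rightarrow> real^3) \<Rightarrow> (real \<Rightarrow> real^3) \<Rightarrow> real" where
  "T0 c z y = (THE T. T > 0 \<and> g_fun c y z T 0 = 0)"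

text \<open>The restriction to \<open>[0,\<infinity>)\<close> makes sure that a mapping applied to \<open>d_rec\<close> has no access to
  values at negative times.\<close>

definition d_rec ::
  "real \<Rightarrow> (real \<Rightarrow> real^3) \<Rightarrow> (real \<Rightarrow> real^3) \<Rightarrow> real \<Rightarrow> real" where
  "d_rec c xi y = (\<lambda>t\<in>{0..}. norm (xi (h_fun c xi y t) - y t))"

definition d_em ::
  "real \<Rightarrow> (real \<Rightarrow> real^3) \<Rightarrow> (real \<Rightarrow> real^3) \<Rightarrow> real \<Rightarrow> real" where
  "d_em c z y = (\<lambda>t\<in>{T0 c z y..}. norm (y t - z (inv_into {0..} (h_fun c y z) t)))"

end

theory Submission
  imports Defs
begin

text \<open>
  A signal that the scatterer sends out at time \<open>t\<close> reaches receiver \<open>i\<close> at the time \<open>h\<^sub>i t\<close>, and the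
  defining equation \<open>g\<^sub>i (h\<^sub>i t) t = 0\<close> says that the travel time is \<open>d\<^sub>i t / c\<close>. Hence
  \<open>h\<^sub>i t = t + d\<^sub>i t / c\<close>: the distance function alone reveals when, and therefore where, the
  receiver was hit. So \<open>y t\<close> lies on four spheres with known radii \<open>d\<^sub>i t\<close> and known centres
  \<open>x\<^sub>i (t + d\<^sub>i t / c)\<close> (\<open>d_rec_props\<close>). Two different points on all of these spheres would put the
  centres into their perpendicular bisector plane, contrary to the admissibility condition that the
  receiver positions at positive times are never coplanar; so \<open>y t\<close> is the only common point
  (\<open>trilateration\<close>), and \<open>\<G>\<close> returns that point. The mapping \<open>\<F>\<close> then evaluates the emitter
  distance for the reconstructed trajectory; this is legitimate because the emitter distance sees
  the scatterer trajectory only at nonnegative times (\<open>d_em_cong\<close>).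

  The arrival time function is introduced by a definite description, so the argument needs that it
  exists and is unique (\<open>h_fun_eq_arrival\<close>). Because all speeds are bounded by a constant \<open>k < c\<close>, the
  function \<open>g\<close> grows in the reception time at rate at least \<open>1 - k / c > 0\<close> and decreases in the
  emission time. This gives existence, uniqueness, strict monotonicity and Lipschitz continuity of
  the arrival time; its continuous differentiability is implicit differentiation of \<open>g = 0\<close>, which
  is possible because source and receiver never meet, so that their distance is differentiable.
\<close>

section \<open>Trajectories of bounded speed\<close>

text \<open>The speed is a two-sided notion and is bounded at positive times only; continuity of the
  derivative carries the bound over to the one-sided derivative at \<open>0\<close>, at the price of
  strictness.\<close>

lemma C1_halfline_speed_bound:
  fixes f :: "real \<Rightarrow> 'a::real_normed_vector"
  assumes "C1_halfline f" and slow: "\<And>t. t > 0 \<Longrightarrow> speed f t < k"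
  obtains f' where "\<And>t. t \<ge> 0 \<Longrightarrow> (f has_vector_derivative f' t) (at t within {0..})"
    and "continuous_on {0..} f'" and "\<And>t. t \<ge> 0 \<Longrightarrow> norm (f' t) \<le> k"
proof -
  obtain f' where f': "\<And>t. t \<ge> 0 \<Longrightarrow> (f has_vector_derivative f' t) (at t within {0..})"
    and cont: "continuous_on {0..} f'"
    using assms(1) unfolding C1_halfline_def by auto
  have inner: "norm (f' t) \<le> k" if "t \<in> {0<..}" for t
  proof -
    have "(f has_vector_derivative f' t) (at t)"
      using f'[of t] that at_within_interior[of t "{0..}"] by simp
    then show ?thesis
      using slow[of t] that by (simp add: speed_def vector_derivative_at)
  qed
  have "norm (f' t) \<le> k" if "t \<ge> 0" for t
  proof (rule continuous_le_on_closure[where S = "{0<..}" and f = "\<lambda>t. norm (f' t)"])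
    show "continuous_on (closure {0<..}) (\<lambda>t. norm (f' t))"
      using continuous_on_norm[OF cont] by simp
    show "t \<in> closure {0<..}" using that by simp
  qed (rule inner)
  with f' cont show thesis by (rule that)
qed

lemma halfline_lipschitz:
  fixes f :: "real \<Rightarrow> 'a::real_normed_vector"
  assumes "\<And>t. t \<ge> 0 \<Longrightarrow> (f has_vector_derivative f' t) (at t within {0..})"
    and "\<And>t. t \<ge> 0 \<Longrightarrow> norm (f' t) \<le> k" and "s \<ge> 0" "t \<ge> 0"
  shows "norm (f s - f t) \<le> k * \<bar>s - t\<bar>"
proof -
  have "norm (f s - f t) \<le> k * norm (s - t)"
  proof (rule differentiable_bound[where S = "{0..}" and f' = "\<lambda>t v. v *\<^sub>R f' t"])
    fix r :: real assume r: "r \<in> {0..}"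
    then show "(f has_derivative (\<lambda>v. v *\<^sub>R f' r)) (at r within {0..})"
      using assms(1) by (auto simp: has_vector_derivative_def)
    show "onorm (\<lambda>v. v *\<^sub>R f' r) \<le> k"
      using assms(2)[of r] r by (intro onorm_le) (simp add: mult.commute[of k] mult_left_mono)
  qed (use assms in auto)
  then show ?thesis by simp
qed

text \<open>Implicit differentiation relative to a set, so that it also covers the end point \<open>0\<close> of the
  half line, where the implicit function theorem on open sets does not apply. The Lipschitz bound
  on \<open>h\<close> turns the remainder \<open>o(\<bar>h r - h s\<bar> + \<bar>r - s\<bar>)\<close> in the linearisation of \<open>F\<close> into
  \<open>o(\<bar>r - s\<bar>)\<close>; solving the linearised equation for \<open>h r - h s\<close> gives the derivative.\<close>

lemma implicit_lipschitz_has_real_derivative: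
  fixes F :: "real \<Rightarrow> real \<Rightarrow> real" and h :: "real \<Rightarrow> real"
  assumes F: "((\<lambda>p. F (fst p) (snd p)) has_derivative (\<lambda>(u, v). A * u + B * v)) (at (h s, s) within T \<times> S)"
    and "A \<noteq> 0" and "s \<in> S"
    and zero: "\<And>r. r \<in> S \<Longrightarrow> h r \<in> T \<and> F (h r) r = 0"
    and lip: "\<And>r. r \<in> S \<Longrightarrow> \<bar>h r - h s\<bar> \<le> L * \<bar>r - s\<bar>" and "L \<ge> 0"
  shows "(h has_real_derivative - B / A) (at s within S)"
  unfolding has_field_derivative_def has_derivative_within_alt
proof (intro conjI allI impI)
  show "bounded_linear ((*) (- B / A))" by (rule bounded_linear_mult_right)
next
  fix e :: real assume "e > 0"
  \<comment> \<open>\<open>L + 1\<close> bounds the length of the step \<open>(h r - h s, r - s)\<close> per unit of \<open>r - s\<close>, and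
    the factor \<open>\<bar>A\<bar>\<close> is lost again when the linearised equation is divided by \<open>A\<close>.\<close>
  define e' where "e' = e * \<bar>A\<bar> / (L + 1)"
  have "e' > 0" using \<open>e > 0\<close> \<open>A \<noteq> 0\<close> \<open>L \<ge> 0\<close> by (simp add: e'_def)
  then obtain d where "d > 0" and d: "\<And>p. p \<in> T \<times> S \<Longrightarrow> norm (p - (h s, s)) < d \<Longrightarrow>
      norm (F (fst p) (snd p) - F (h s) s - (case p - (h s, s) of (u, v) \<Rightarrow> A * u + B * v))
        \<le> e' * norm (p - (h s, s))"
    using F unfolding has_derivative_within_alt fst_conv snd_conv by blast
  have "norm (h r - h s - - B / A * (r - s)) \<le> e * norm (r - s)"
    if "r \<in> S" "norm (r - s) < d / (L + 1)" for r
  proof -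
    have "norm ((h r, r) - (h s, s)) \<le> \<bar>h r - h s\<bar> + \<bar>r - s\<bar>"
      using norm_Pair_le[of "h r - h s" "r - s"] by simp
    also have "\<dots> \<le> (L + 1) * \<bar>r - s\<bar>" using lip[OF \<open>r \<in> S\<close>] by (simp add: algebra_simps)
    finally have le: "norm ((h r, r) - (h s, s)) \<le> (L + 1) * \<bar>r - s\<bar>" .
    also have "\<dots> < d" using that(2) \<open>L \<ge> 0\<close> by (simp add: field_simps)
    finally have "norm ((h r, r) - (h s, s)) < d" .
    then have "\<bar>A * (h r - h s) + B * (r - s)\<bar> \<le> e' * norm ((h r, r) - (h s, s))"
      using d[of "(h r, r)"] zero[OF \<open>r \<in> S\<close>] zero[OF \<open>s \<in> S\<close>] \<open>r \<in> S\<close>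
      by (simp add: abs_minus_commute)
    also have "\<dots> \<le> e' * ((L + 1) * \<bar>r - s\<bar>)"
      using le \<open>e' > 0\<close> by (intro mult_left_mono) auto
    also have "\<dots> = e * \<bar>r - s\<bar> * \<bar>A\<bar>" using \<open>L \<ge> 0\<close> by (simp add: e'_def)
    finally have "\<bar>A * (h r - h s) + B * (r - s)\<bar> / \<bar>A\<bar> \<le> e * \<bar>r - s\<bar>"
      using \<open>A \<noteq> 0\<close> by (simp add: pos_divide_le_eq)
    moreover have "h r - h s - - B / A * (r - s) = (A * (h r - h s) + B * (r - s)) / A"
      using \<open>A \<noteq> 0\<close> by (simp add: field_simps)
    ultimately show ?thesis by (simp add: abs_divide)
  qed
  moreover have "d / (L + 1) > 0" using \<open>d > 0\<close> \<open>L \<ge> 0\<close> by simp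
  ultimately show "\<exists>d>0. \<forall>r\<in>S. norm (r - s) < d \<longrightarrow>
      norm (h r - h s - - B / A * (r - s)) \<le> e * norm (r - s)" by blast
qed

section \<open>Arrival times\<close>

text \<open>The source \<open>b\<close> sends signals to the observer \<open>a\<close>. Both situations of interest are
  instances: the scatterer as source for a receiver, and the emitter as source for the
  scatterer.\<close>

locale slow_signal =
  fixes c k :: real and a a' b b' :: "real \<Rightarrow> real^3"
  assumes k_nonneg: "0 \<le> k" and k_less: "k < c"
    and deriv_a: "\<And>t. t \<ge> 0 \<Longrightarrow> (a has_vector_derivative a' t) (at t within {0..})"
    and deriv_b: "\<And>t. t \<ge> 0 \<Longrightarrow> (b has_vector_derivative b' t) (at t within {0..})"
    and cont_a': "continuous_on {0..} a'" and cont_b': "continuous_on {0..} b'"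
    and norm_a': "\<And>t. t \<ge> 0 \<Longrightarrow> norm (a' t) \<le> k"
    and norm_b': "\<And>t. t \<ge> 0 \<Longrightarrow> norm (b' t) \<le> k"
    and apart: "\<And>t s. t \<ge> 0 \<Longrightarrow> s \<ge> 0 \<Longrightarrow> a t \<noteq> b s"
begin

abbreviation g :: "real \<Rightarrow> real \<Rightarrow> real" where "g \<equiv> g_fun c a b"

lemma c_pos: "c > 0" using k_nonneg k_less by simp

lemma ratio_less: "k / c < 1" using c_pos k_less by simp

lemma a_lipschitz: "s \<ge> 0 \<Longrightarrow> t \<ge> 0 \<Longrightarrow> norm (a s - a t) \<le> k * \<bar>s - t\<bar>"
  using halfline_lipschitz[OF deriv_a norm_a'] by blast

lemma b_lipschitz: "s \<ge> 0 \<Longrightarrow> t \<ge> 0 \<Longrightarrow> norm (b s - b t) \<le> k * \<bar>s - t\<bar>"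
  using halfline_lipschitz[OF deriv_b norm_b'] by blast

lemma continuous_a: "continuous_on {0..} a"
  using deriv_a by (intro continuous_on_vector_derivative) auto

lemma continuous_b: "continuous_on {0..} b"
  using deriv_b by (intro continuous_on_vector_derivative) auto

text \<open>In the time \<open>t' - t\<close> the observer can increase its distance to a fixed point by at most
  \<open>k * (t' - t)\<close>, so \<open>g\<close> loses at most the fraction \<open>k / c\<close> of what it gains from \<open>t\<close>.\<close>

lemma g_reception_growth:
  assumes "0 \<le> t" "t \<le> t'"
  shows "(1 - k / c) * (t' - t) \<le> g t' s - g t s"
proof -
  have "norm (a t' - b s) \<le> norm (a t - b s) + k * (t' - t)"
    using a_lipschitz[of t' t] assms norm_triangle_ineq[of "a t - b s" "a t' - a t"] by simp
  then have "norm (a t' - b s) / c \<le> (norm (a t - b s) + k * (t' - t)) / c"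
    using c_pos by (simp add: divide_right_mono)
  then show ?thesis by (simp add: g_fun_def algebra_simps add_divide_distrib diff_divide_distrib)
qed

lemma g_emission_decay:
  assumes "0 \<le> s" "s \<le> s'"
  shows "(1 - k / c) * (s' - s) \<le> g t s - g t s'" "g t s - g t s' \<le> (1 + k / c) * (s' - s)"
proof -
  have "\<bar>norm (a t - b s') - norm (a t - b s)\<bar> \<le> k * (s' - s)"
    using b_lipschitz[of s' s] assms norm_triangle_ineq3[of "a t - b s'" "a t - b s"]
    by (simp add: norm_minus_commute)
  then have "\<bar>norm (a t - b s') - norm (a t - b s)\<bar> / c \<le> k * (s' - s) / c"
    using c_pos by (simp add: divide_right_mono)
  then have "\<bar>norm (a t - b s') / c - norm (a t - b s) / c\<bar> \<le> k * (s' - s) / c"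
    using c_pos by (metis abs_divide abs_of_pos diff_divide_distrib)
  then show "(1 - k / c) * (s' - s) \<le> g t s - g t s'" "g t s - g t s' \<le> (1 + k / c) * (s' - s)"
    unfolding g_fun_def
    by (auto simp: abs_le_iff algebra_simps add_divide_distrib diff_divide_distrib)
qed

lemma g_reception_mono:
  assumes "0 \<le> t" "t < t'" shows "g t s < g t' s"
proof -
  have "0 < (1 - k / c) * (t' - t)" using ratio_less assms by simp
  then show ?thesis using g_reception_growth[of t t' s] assms by linarith
qed

lemma g_emission_antimono:
  assumes "0 \<le> s" "s < s'" shows "g t s' < g t s"
proof -
  have "0 < (1 - k / c) * (s' - s)" using ratio_less assms by simp
  then show ?thesis using g_emission_decay(1)[of s s' t] assms by linarith
qed

lemma ex1_arrival:
  assumes "s \<ge> 0"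
  shows "\<exists>!t. t \<ge> 0 \<and> g t s = 0"
proof -
  \<comment> \<open>Growth at rate at least \<open>1 - k / c\<close> from the value \<open>g 0 s \<le> 0\<close> makes \<open>g\<close> nonnegative by
    this time.\<close>
  define t1 where "t1 = - g 0 s / (1 - k / c)"
  have g0: "g 0 s \<le> 0"
    using assms divide_nonneg_pos[OF norm_ge_zero c_pos, of "a 0 - b s"] by (simp add: g_fun_def)
  have "t1 \<ge> 0" using g0 ratio_less by (auto simp: t1_def intro: divide_nonpos_pos)
  then have "- g 0 s \<le> g t1 s - g 0 s"
  proof -
    have "(1 - k / c) * (t1 - 0) = - g 0 s" using ratio_less unfolding t1_def by simp (use k_less in simp)
    then show ?thesis using g_reception_growth[of 0 t1 s] \<open>t1 \<ge> 0\<close> by simp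
  qed
  moreover have "continuous_on {0..t1} (\<lambda>t. g t s)"
    unfolding g_fun_def
    by (intro continuous_intros continuous_on_subset[OF continuous_a]) (use c_pos in auto)
  ultimately obtain t where t: "t \<ge> 0" "g t s = 0"
    using IVT'[of "\<lambda>t. g t s" 0 0 t1] g0 \<open>t1 \<ge> 0\<close> by auto
  moreover have "t' = t" if "t' \<ge> 0" "g t' s = 0" for t'
    using g_reception_mono[of t t' s] g_reception_mono[of t' t s] t that by force
  ultimately show ?thesis by blast
qed

definition arrival :: "real \<Rightarrow> real" where
  "arrival = (\<lambda>s\<in>{0..}. THE t. t \<ge> 0 \<and> g t s = 0)"

lemma arrival_zero: "s \<ge> 0 \<Longrightarrow> arrival s \<ge> 0" "s \<ge> 0 \<Longrightarrow> g (arrival s) s = 0"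
  using theI'[OF ex1_arrival] by (auto simp: arrival_def)

text \<open>Were the later signal to arrive no later, monotonicity of \<open>g\<close> in both arguments would force
  \<open>0 = g (arrival s') s' \<le> g (arrival s) s' < g (arrival s) s = 0\<close>.\<close>

lemma arrival_mono:
  assumes "0 \<le> s" "s < s'" shows "arrival s < arrival s'"
proof (rule ccontr)
  assume "\<not> arrival s < arrival s'"
  then have "g (arrival s') s' \<le> g (arrival s) s'"
    using g_reception_mono[of "arrival s'" "arrival s" s'] arrival_zero(1)[of s'] assms
    by (cases "arrival s' = arrival s") auto
  also have "\<dots> < g (arrival s) s" using assms by (rule g_emission_antimono)
  finally show False using arrival_zero(2) assms by simp
qed

text \<open>Along \<open>g (arrival s) s = 0\<close> the increase of \<open>g\<close> in the reception time must balance its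
  decrease in the emission time; the constant is the quotient of the extreme rates.\<close>

lemma arrival_lipschitz:
  assumes "s \<ge> 0" "s' \<ge> 0"
  shows "\<bar>arrival s' - arrival s\<bar> \<le> (1 + k / c) / (1 - k / c) * \<bar>s' - s\<bar>"
proof -
  have *: "arrival s' - arrival s \<le> (1 + k / c) / (1 - k / c) * (s' - s)"
    if "0 \<le> s" "s < s'" for s s'
  proof -
    have "(1 - k / c) * (arrival s' - arrival s) \<le> g (arrival s') s' - g (arrival s) s'"
      using that arrival_mono[of s s'] arrival_zero(1) by (intro g_reception_growth) auto
    also have "\<dots> = g (arrival s) s - g (arrival s) s'" using that arrival_zero(2) by simp
    also have "\<dots> \<le> (1 + k / c) * (s' - s)" using that by (intro g_emission_decay) auto
    finally show ?thesis using ratio_less by (simp add: pos_le_divide_eq mult.commute)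
  qed
  show ?thesis
    using *[of s s'] *[of s' s] arrival_mono[of s s'] arrival_mono[of s' s] assms
    by (cases s s' rule: linorder_cases) auto
qed

text \<open>The direction in which the signal travels, which is also the gradient of the distance.\<close>

definition dir :: "real \<Rightarrow> real^3" where
  "dir s = sgn (a (arrival s) - b s)"

lemma g_has_derivative:
  assumes "s \<ge> 0"
  shows "((\<lambda>p. g (fst p) (snd p)) has_derivative
     (\<lambda>(u, v). (1 - dir s \<bullet> a' (arrival s) / c) * u + (dir s \<bullet> b' s / c - 1) * v))
     (at (arrival s, s) within {0..} \<times> {0..})"
proof -
  let ?S = "{0..} \<times> {0..} :: (real \<times> real) set"
  have "((a \<circ> fst) has_derivative (\<lambda>v. v *\<^sub>R a' (arrival s)) \<circ> fst) (at (arrival s, s) within ?S)"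
    using deriv_a[of "arrival s"] arrival_zero(1)[OF assms]
    by (intro diff_chain_within has_derivative_fst has_derivative_ident)
      (auto simp: has_vector_derivative_def intro: has_derivative_subset)
  moreover have "((b \<circ> snd) has_derivative (\<lambda>v. v *\<^sub>R b' s) \<circ> snd) (at (arrival s, s) within ?S)"
    using deriv_b[of s] assms
    by (intro diff_chain_within has_derivative_snd has_derivative_ident)
      (auto simp: has_vector_derivative_def intro: has_derivative_subset)
  ultimately have "((\<lambda>p. a (fst p) - b (snd p)) has_derivative
      (\<lambda>p. fst p *\<^sub>R a' (arrival s) - snd p *\<^sub>R b' s)) (at (arrival s, s) within ?S)"
    by (auto intro: has_derivative_diff simp: o_def)
  moreover have "a (arrival s) - b s \<noteq> 0" using apart arrival_zero(1) assms by simp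
  ultimately have "((\<lambda>p. norm (a (fst p) - b (snd p))) has_derivative
      (\<lambda>p. (fst p *\<^sub>R a' (arrival s) - snd p *\<^sub>R b' s) \<bullet> dir s)) (at (arrival s, s) within ?S)"
    using has_derivative_compose[where f = "\<lambda>p. a (fst p) - b (snd p)" and x = "(arrival s, s)",
        OF _ has_derivative_norm]
    by (simp add: dir_def)
  then have "((\<lambda>p. fst p - snd p - norm (a (fst p) - b (snd p)) / c) has_derivative
      (\<lambda>p. fst p - snd p - ((fst p *\<^sub>R a' (arrival s) - snd p *\<^sub>R b' s) \<bullet> dir s) / c))
      (at (arrival s, s) within ?S)"
    by (intro has_derivative_diff has_derivative_fst has_derivative_snd has_derivative_ident
        bounded_linear.has_derivative[OF bounded_linear_divide])
  then show ?thesis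
    unfolding g_fun_def
    by (rule has_derivative_eq_rhs) (auto simp: fun_eq_iff algebra_simps inner_diff_left inner_commute diff_divide_distrib)
qed

text \<open>The partial derivative of \<open>g\<close> in the reception time does not vanish on the solution curve,
  since the observer recedes from the source more slowly than the signal travels.\<close>

lemma doppler_factor_pos:
  assumes "s \<ge> 0" shows "1 - dir s \<bullet> a' (arrival s) / c > 0"
proof -
  have "dir s \<bullet> a' (arrival s) \<le> norm (dir s) * norm (a' (arrival s))" by (rule norm_cauchy_schwarz)
  also have "\<dots> \<le> 1 * k"
    using norm_a' arrival_zero(1)[OF assms] by (intro mult_mono) (auto simp: dir_def norm_sgn)
  finally show ?thesis using k_less c_pos by simp
qed

lemma arrival_C1: "C1_halfline arrival"
proof -
  \<comment> \<open>The Doppler quotient, obtained by solving the differentiated equation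
    \<open>g (arrival s) s = 0\<close> for the derivative of the arrival time.\<close>
  define h' where "h' s = - (dir s \<bullet> b' s / c - 1) / (1 - dir s \<bullet> a' (arrival s) / c)" for s
  have der: "(arrival has_real_derivative h' s) (at s within {0..})" if "s \<ge> 0" for s
    unfolding h'_def
  proof (rule implicit_lipschitz_has_real_derivative[where F = g and T = "{0..}"])
    show "((\<lambda>p. g (fst p) (snd p)) has_derivative (\<lambda>(u, v).
        (1 - dir s \<bullet> a' (arrival s) / c) * u + (dir s \<bullet> b' s / c - 1) * v))
        (at (arrival s, s) within {0..} \<times> {0..})" using that by (rule g_has_derivative)
    show "1 - dir s \<bullet> a' (arrival s) / c \<noteq> 0" using doppler_factor_pos[OF that] by linarith
    show "0 \<le> (1 + k / c) / (1 - k / c)" using ratio_less k_nonneg c_pos by simp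
  qed (use that arrival_lipschitz arrival_zero in auto)
  have arr: "continuous_on {0..} arrival"
    using der by (intro DERIV_continuous_on) auto
  have sub: "arrival ` {0..} \<subseteq> {0..}" using arrival_zero(1) by auto
  have "continuous_on {0..} (\<lambda>s. a (arrival s))" "continuous_on {0..} (\<lambda>s. a' (arrival s))"
    using continuous_on_compose2[OF continuous_a arr sub] continuous_on_compose2[OF cont_a' arr sub]
    by auto
  moreover have "continuous_on {0..} dir"
    unfolding dir_def
    by (intro continuous_on_sgn continuous_intros continuous_b calculation(1))
      (use apart arrival_zero(1) in auto)
  ultimately have "continuous_on {0..} h'"
    unfolding h'_def using cont_b' c_pos doppler_factor_pos
    by (intro continuous_intros) (auto simp: less_imp_neq[symmetric])
  then show ?thesis
    unfolding C1_halfline_def using der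
    by (auto simp flip: has_real_derivative_iff_has_vector_derivative)
qed

lemma h_fun_eq_arrival: "h_fun c a b = arrival"
  unfolding h_fun_def
proof (rule the_equality)
  show "arrival \<in> {0..} \<rightarrow>\<^sub>E {0..} \<and> C1_halfline arrival \<and> strict_mono_on {0..} arrival \<and>
      (\<forall>s\<ge>0. g (arrival s) s = 0)"
    using arrival_C1 arrival_zero arrival_mono by (auto simp: strict_mono_on_def arrival_def)
next
  fix h
  assume h: "h \<in> {0..} \<rightarrow>\<^sub>E {0..} \<and> C1_halfline h \<and> strict_mono_on {0..} h \<and>
      (\<forall>s\<ge>0. g (h s) s = 0)"
  show "h = arrival"
  proof
    fix s
    show "h s = arrival s"
    proof (cases "s \<ge> 0")
      case True
      then have "h s \<ge> 0" "g (h s) s = 0" using h by auto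
      then show ?thesis using ex1_arrival[OF True] arrival_zero[OF True] by blast
    next
      case False
      then show ?thesis using h by (simp add: arrival_def PiE_def extensional_def)
    qed
  qed
qed

text \<open>Since the travel time is \<open>d_rec c a b t / c\<close>, the measured distance determines the time of
  arrival, and thereby a sphere around a known position of the observer that contains \<open>b t\<close>.\<close>

lemma d_rec_props:
  assumes "t \<ge> 0"
  shows "d_rec c a b t > 0" "norm (a (t + d_rec c a b t / c) - b t) = d_rec c a b t"
proof -
  have d: "d_rec c a b t = norm (a (arrival t) - b t)"
    using assms by (simp add: d_rec_def h_fun_eq_arrival)
  then have "arrival t = t + d_rec c a b t / c"
    using arrival_zero(2)[OF assms] by (simp add: g_fun_def)
  with d show "norm (a (t + d_rec c a b t / c) - b t) = d_rec c a b t" by simp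
  show "d_rec c a b t > 0" using d apart arrival_zero(1) assms by simp
qed

text \<open>The first signal arrives at \<open>T0\<close>. Its positivity ensures that the emitter distance, which is
  considered from \<open>T0\<close> on, involves \<open>a\<close> at nonnegative times only.\<close>

lemma T0_pos: "T0 c b a > 0"
proof -
  \<comment> \<open>Time \<open>0\<close> is no solution because the two trajectories start apart.\<close>
  have eq: "(t > 0 \<and> g_fun c a b t 0 = 0) \<longleftrightarrow> (t \<ge> 0 \<and> g_fun c a b t 0 = 0)" for t
    using apart[of 0 0] c_pos by (cases "t = 0") (auto simp: g_fun_def)
  show ?thesis
    using theI'[of "\<lambda>t. t > 0 \<and> g_fun c a b t 0 = 0"] ex1_arrival[of 0]
    unfolding T0_def eq[symmetric] by simp
qed

end

section \<open>Locating the scatterer\<close>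

text \<open>The points equidistant from \<open>p\<close> and \<open>q\<close> form the perpendicular bisector plane; an affine
  basis of a plane has three elements.\<close>

lemma equidistant_imp_coplanar:
  fixes p q :: "real^3"
  assumes "p \<noteq> q" and "\<And>v. v \<in> S \<Longrightarrow> norm (v - p) = norm (v - q)"
  shows "coplanar S"
proof -
  let ?H = "{v. (q - p) \<bullet> v = (q \<bullet> q - p \<bullet> p) / 2}"
  have "S \<subseteq> ?H"
  proof
    fix v assume "v \<in> S"
    then have "(v - p) \<bullet> (v - p) = (v - q) \<bullet> (v - q)"
      using assms(2) by (simp add: norm_eq)
    then show "v \<in> ?H" by (simp add: inner_diff_left inner_diff_right inner_commute)
  qed
  moreover have "coplanar ?H"
  proof -
    have dim: "aff_dim ?H = 2" using assms(1) by (subst aff_dim_hyperplane) auto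
    obtain B where B: "affine hull B = affine hull ?H" "\<not> affine_dependent B"
      "of_nat (card B) = aff_dim ?H + 1"
      using aff_dim_inner_basis_exists[of ?H] by blast
    have "coplanar B"
      using B(3) dim aff_independent_finite[OF B(2)] by (intro coplanar_small) auto
    then show ?thesis using B(1) coplanar_affine_hull_coplanar by metis
  qed
  ultimately show ?thesis by (rule coplanar_subset[rotated])
qed

lemma trilateration:
  fixes p :: "'i \<Rightarrow> real^3"
  assumes "\<not> coplanar (range p)" and "\<And>i. norm (p i - q) = r i"
  shows "(THE v. \<forall>i. norm (p i - v) = r i) = q"
proof (rule the_equality)
  fix v assume "\<forall>i. norm (p i - v) = r i"
  then show "v = q"
    using equidistant_imp_coplanar[of v q "range p"] assms by fastforce
qed (use assms in auto)

text \<open>Two observers that agree at nonnegative times yield the same \<open>T0\<close>, arrival times and emitter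
  distance. This is needed because the reconstruction recovers the scatterer at those times
  only.\<close>

lemma g_fun_cong_observer:
  assumes "\<And>t. t \<ge> 0 \<Longrightarrow> y t = y' t" "t \<ge> 0"
  shows "g_fun c y z t s = g_fun c y' z t s"
  using assms by (simp add: g_fun_def)

lemma T0_cong:
  assumes "\<And>t. t \<ge> 0 \<Longrightarrow> y t = y' t"
  shows "T0 c z y = T0 c z y'"
  unfolding T0_def using g_fun_cong_observer[of y y'] assms
  by (intro arg_cong[where f = The]) (auto simp: fun_eq_iff)

lemma h_fun_cong_observer:
  assumes "\<And>t. t \<ge> 0 \<Longrightarrow> y t = y' t"
  shows "h_fun c y z = h_fun c y' z"
  unfolding h_fun_def
proof (intro arg_cong[where f = The] ext conj_cong refl)
  fix h :: "real \<Rightarrow> real" assume "h \<in> {0..} \<rightarrow>\<^sub>E {0..}"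
  then have "h s \<ge> 0" if "s \<ge> 0" for s using that by auto
  then show "(\<forall>s\<ge>0. g_fun c y z (h s) s = 0) = (\<forall>s\<ge>0. g_fun c y' z (h s) s = 0)"
    using g_fun_cong_observer[of y y'] assms by auto
qed

lemma d_em_cong:
  assumes "\<And>t. t \<ge> 0 \<Longrightarrow> y t = y' t" "t \<ge> 0"
  shows "d_em c z y t = d_em c z y' t"
proof -
  have "T0 c z y = T0 c z y'" by (rule T0_cong) (rule assms(1))
  moreover have "h_fun c y z = h_fun c y' z" by (rule h_fun_cong_observer) (rule assms(1))
  moreover have "y t = y' t" using assms by blast
  ultimately show ?thesis unfolding d_em_def restrict_def by (simp only:)
qed

text \<open>The domains \<open>\<Omega>\<^sub>1 \<subseteq> \<Omega>\<^sub>2\<close> serve to keep the scatterer away from emitter and receivers, even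
  when their positions are compared at different times.\<close>

lemma admissible_slow_signals:
  assumes "admissible c z x y"
  obtains k y' z' x' where "slow_signal c k y y' z z'"
    and "\<And>i. slow_signal c k (x i) (x' i) y y'"
proof -
  note adm = assms[unfolded admissible_def]
  have C1: "C1_halfline z" "C1_halfline y" "C1_halfline (x i)" for i
    using adm[THEN conjunct1] adm[THEN conjunct2, THEN conjunct1]
      adm[THEN conjunct2, THEN conjunct2, THEN conjunct1] by iprover+
  have speeds: "\<exists>k. 0 < k \<and> k < c \<and>
      (\<forall>t>0. speed z t < k \<and> speed y t < k \<and> (\<forall>i. speed (x i) t < k))"
    using adm by (elim conjE)
  have domains: "\<exists>\<Omega>\<^sub>1 \<Omega>\<^sub>2. smooth_bounded_domain \<Omega>\<^sub>1 \<and> smooth_bounded_domain \<Omega>\<^sub>2 \<and> \<Omega>\<^sub>1 \<subseteq> \<Omega>\<^sub>2 \<and>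
      (\<forall>t\<ge>0. y t \<in> \<Omega>\<^sub>1 \<and> z t \<notin> closure \<Omega>\<^sub>2 \<and> (\<forall>i. x i t \<notin> closure \<Omega>\<^sub>2))"
    using adm by (elim conjE)
  obtain k where k: "0 < k" "k < c"
    and slow: "\<And>t. t > 0 \<Longrightarrow> speed z t < k" "\<And>t. t > 0 \<Longrightarrow> speed y t < k"
      "\<And>t i. t > 0 \<Longrightarrow> speed (x i) t < k"
    using speeds by auto
  obtain \<Omega>\<^sub>1 \<Omega>\<^sub>2 where \<Omega>: "\<Omega>\<^sub>1 \<subseteq> \<Omega>\<^sub>2"
    "\<And>t. t \<ge> 0 \<Longrightarrow> y t \<in> \<Omega>\<^sub>1 \<and> z t \<notin> closure \<Omega>\<^sub>2 \<and> (\<forall>i. x i t \<notin> closure \<Omega>\<^sub>2)"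
    using domains by auto
  have y_in: "y t \<in> closure \<Omega>\<^sub>2" if "t \<ge> 0" for t
    using \<Omega> that closure_subset by blast
  let ?good = "\<lambda>f f'. (\<forall>t\<ge>0. (f has_vector_derivative f' t) (at t within {0..})) \<and>
      continuous_on {0..} f' \<and> (\<forall>t\<ge>0. norm (f' t) \<le> k)"
  have good: "\<exists>f'. ?good f f'" if "C1_halfline f" "\<And>t. t > 0 \<Longrightarrow> speed f t < k"
    for f :: "real \<Rightarrow> real^3"
    by (rule C1_halfline_speed_bound[OF that]) auto
  obtain z' y' where der: "?good z z'" "?good y y'"
    using good[OF C1(1) slow(1)] good[OF C1(2) slow(2)] by auto
  have "\<forall>i. \<exists>f'. ?good (x i) f'" using good[OF C1(3) slow(3)] by simp
  then obtain x' where der_x: "\<And>i. ?good (x i) (x' i)" by metis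
  have ne: "y t \<noteq> z s" "x i t \<noteq> y s" if "t \<ge> 0" "s \<ge> 0" for t s i
    using y_in \<Omega>(2) that by metis+
  show thesis
  proof
    show "slow_signal c k y y' z z'"
      using k der(1,2) ne(1) by unfold_locales auto
    show "slow_signal c k (x i) (x' i) y y'" for i
      using k der_x[of i] der(2) ne(2) by unfold_locales auto
  qed
qed

theorem theorem4p5:
  fixes c :: real
    and z :: "real \<Rightarrow> real^3"
    and x :: "4 \<Rightarrow> real \<Rightarrow> real^3"
  assumes "c > 0"
  shows "\<exists>(\<G> :: (4 \<Rightarrow> real \<Rightarrow> real) \<Rightarrow> real \<Rightarrow> real^3) (\<F> :: (4 \<Rightarrow> real \<Rightarrow> real) \<Rightarrow> real \<Rightarrow> real).
           \<forall>y. admissible c z x y \<longrightarrow>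
             (\<forall>t\<ge>0. y t = \<G> (\<lambda>i. d_rec c (x i) y) t) \<and>
             (\<forall>t\<ge>T0 c z y. d_em c z y t = \<F> (\<lambda>i. d_rec c (x i) y) t)"
proof -
  define G :: "(4 \<Rightarrow> real \<Rightarrow> real) \<Rightarrow> real \<Rightarrow> real^3"
    where "G d t = (THE v. \<forall>i. norm (x i (t + d i t / c) - v) = d i t)" for d t
  have "(\<forall>t\<ge>0. y t = G (\<lambda>i. d_rec c (x i) y) t) \<and>
        (\<forall>t\<ge>T0 c z y. d_em c z y t = d_em c z (G (\<lambda>i. d_rec c (x i) y)) t)"
    if adm: "admissible c z x y" for y
  proof -
    let ?d = "\<lambda>i. d_rec c (x i) y"
    obtain k y' z' x' where em: "slow_signal c k y y' z z'"
      and rec: "\<And>i. slow_signal c k (x i) (x' i) y y'"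
      by (rule admissible_slow_signals[OF adm]) (rule that)
    have y_eq: "y t = G ?d t" if "t \<ge> 0" for t
    proof -
      note d = slow_signal.d_rec_props[OF rec that]
      have "t + ?d i t / c > 0" for i
        using that divide_pos_pos[OF d(1) \<open>c > 0\<close>] by (rule add_nonneg_pos)
      moreover have "\<forall>\<tau>. (\<forall>i. \<tau> i > 0) \<longrightarrow> \<not> coplanar (range (\<lambda>i. x i (\<tau> i)))"
        using adm unfolding admissible_def by (elim conjE)
      ultimately have "\<not> coplanar (range (\<lambda>i. x i (t + ?d i t / c)))" by iprover
      then show ?thesis unfolding G_def by (rule trilateration[symmetric]) (rule d(2))
    qed
    have T0: "T0 c z y > 0" using slow_signal.T0_pos[OF em] .
    have "d_em c z y t = d_em c z (G ?d) t" if "t \<ge> T0 c z y" for t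
      using T0 that by (intro d_em_cong y_eq) linarith+
    then show ?thesis using y_eq by (intro conjI allI impI)
  qed
  then show ?thesis
    by (intro exI[of _ G] exI[of _ "\<lambda>d. d_em c z (G d)"] allI impI)
qed

end
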